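(* Let $c>1$ be a real number which is not an integer, let $\|c\|$ denote the distance from $c$ to the nearest integer, and put $\beta = 2^{c+2}(c+2)^2/\|c\|$. Let $H$ be a positive integer. Then there exists $R_0$ (depending on $c$ and $H$) such that for every integer $R\ge R_0$ and every integer $r$, there exists a positive integer $m\le R^{\beta}$ such that $$\lfloor (m+h)^c\rfloor \equiv r+h \pmod R \quad\text{for all integers } h\in[1,H].$$
   Context: $\lfloor u\rfloor$ is the integer part of $u$; $\|u\|=\min(\{u\},1-\{u\})$ where $\{u\}=u-\lfloor u\rfloor$. *)

theory Defs
  imports "HOL-Analysis.Analysis" "HOL-Number_Theory.Cong"
begin

definition dist_nearest_int :: "real \<Rightarrow> real" where
  "dist_nearest_int u = min (frac u) (1 - frac u)"

end

theory Submission
  imports Defs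
begin

text \<open>
  Put \<open>f n = (n\<^sup>c - n - r) / R\<close> and \<open>k = \<lfloor>c\<rfloor>\<close>. As long as \<open>f\<close> modulo 1 stays in \<open>[0, 1 / R)\<close>,
  \<open>\<lfloor>n\<^sup>c\<rfloor>\<close> is congruent to \<open>n + r\<close>, so it suffices to keep \<open>f\<close> there for \<open>R + H\<close> steps and to
  start from a multiple of \<open>R\<close>. Modulo 1, each difference \<open>\<Delta>\<^sup>j f\<close> moves by steps \<open>\<Delta>\<^sup>j\<^sup>+\<^sup>1 f\<close>.
  Far out, \<open>\<Delta>\<^sup>k\<^sup>+\<^sup>1 f\<close> is positive and tiny whereas \<open>\<Delta>\<^sup>k f\<close> is unbounded, so \<open>\<Delta>\<^sup>k f\<close> sweeps
  slowly through the circle; stop it in a small window just above 0, where it remains for a long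
  time. Meanwhile \<open>\<Delta>\<^sup>k\<^sup>-\<^sup>1 f\<close> sweeps the circle in small positive steps and can be stopped in a
  larger window, and so on down to \<open>f\<close> itself. A window of width \<open>w\<close> at level \<open>j\<close> needs width
  about \<open>w\<^sup>2\<close> at level \<open>j + 1\<close>; this doubling of exponents accounts for the factor \<open>2\<^sup>c\<close> in \<open>\<beta>\<close>.
\<close>

definition mem_mod1 :: "real \<Rightarrow> real set \<Rightarrow> bool" where
  "mem_mod1 x S \<longleftrightarrow> (\<exists>z::int. x - of_int z \<in> S)"

lemma mem_mod1_mono: "mem_mod1 x S \<Longrightarrow> S \<subseteq> T \<Longrightarrow> mem_mod1 x T"
  unfolding mem_mod1_def by blast

lemma mem_mod1_diff_Ints:
  assumes "mem_mod1 x S" "x - y \<in> \<int>"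
  shows "mem_mod1 y S"
proof -
  obtain z :: int where z_mem: "x - of_int z \<in> S" using assms(1) unfolding mem_mod1_def by blast
  obtain i :: int where "x - y = of_int i" using assms(2) by (elim Ints_cases)
  then have "y - of_int (z - i) = x - of_int z" by simp
  with z_mem show ?thesis unfolding mem_mod1_def by metis
qed

lemma floor_cong_iff_mem_mod1:
  assumes "0 < R"
  shows "[\<lfloor>x\<rfloor> = a] (mod R) \<longleftrightarrow> mem_mod1 ((x - of_int a) / of_int R) {0..<1 / of_int R}"
proof -
  have "\<lfloor>x\<rfloor> = a + R * z \<longleftrightarrow> (x - of_int a) / of_int R - of_int z \<in> {0..<1 / of_int R}" for z
  proof -
    have "(x - of_int a) / of_int R - of_int z = (x - of_int (a + R * z)) / of_int R"
      using assms by (simp add: field_simps)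
    then show ?thesis
      using assms by (auto simp: floor_eq_iff divide_less_cancel zero_le_divide_iff)
  qed
  moreover have "[\<lfloor>x\<rfloor> = a] (mod R) \<longleftrightarrow> (\<exists>z. \<lfloor>x\<rfloor> = a + R * z)"
    by (metis cong_iff_lin cong_sym_eq)
  ultimately show ?thesis unfolding mem_mod1_def by simp
qed

lemma mem_mod1_steps_lift:
  fixes x :: "nat \<Rightarrow> real"
  assumes "\<And>n. n < N \<Longrightarrow> mem_mod1 (x (Suc n) - x n) S"
  obtains y where "\<And>n. y n - x n \<in> \<int>" "\<And>n. n < N \<Longrightarrow> y (Suc n) - y n \<in> S"
proof -
  obtain z :: "nat \<Rightarrow> int" where z_mem: "\<And>n. n < N \<Longrightarrow> x (Suc n) - x n - z n \<in> S"
    using assms unfolding mem_mod1_def by metis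
  define y where "y n = x n - of_int (\<Sum>i<n. z i)" for n
  show thesis
  proof (rule that)
    show "y n - x n \<in> \<int>" for n by (simp add: y_def del: of_int_sum)
    show "y (Suc n) - y n \<in> S" if "n < N" for n
      using z_mem[OF that] by (simp add: y_def algebra_simps)
  qed
qed

lemma bounded_steps_hit:
  fixes y :: "nat \<Rightarrow> real"
  assumes "\<And>n. n < N \<Longrightarrow> y (Suc n) - y n \<le> v" "0 \<le> v" "q \<in> {y 0..y N}"
  shows "\<exists>n\<le>N. y n \<in> {q..q + v}"
  using assms(1,3)
proof (induction N)
  case 0
  then show ?case using assms(2) by auto
next
  case (Suc N)
  show ?case
  proof (cases "q \<le> y N")
    case True
    then show ?thesis using Suc by (auto intro: le_SucI)
  next
    case False
    then show ?thesis using Suc.prems(1)[of N] Suc.prems(2) by (intro exI[of _ "Suc N"]) auto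
  qed
qed

lemma diff_bounds_of_step_bounds:
  fixes y :: "nat \<Rightarrow> real"
  assumes "\<And>n. n < N \<Longrightarrow> y (m + Suc n) - y (m + n) \<in> {l..u}"
  shows "y (m + N) - y m \<in> {real N * l..real N * u}"
proof -
  have "y (m + N) - y m = (\<Sum>n<N. y (m + Suc n) - y (m + n))"
    using sum_lessThan_telescope[of "\<lambda>n. y (m + n)" N] by simp
  then show ?thesis
    using assms sum_bounded_below[of "{..<N}" l "\<lambda>n. y (m + Suc n) - y (m + n)"]
      sum_bounded_above[of "{..<N}" "\<lambda>n. y (m + Suc n) - y (m + n)" u] by auto
qed

lemma slow_sweep_stays:
  fixes y :: "nat \<Rightarrow> real"
  assumes step: "\<And>n. n < N + L \<Longrightarrow> y (Suc n) - y n \<in> {0..v}" and turn: "1 \<le> y N - y 0"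
    and width: "(real L + 1) * v \<le> w"
  shows "\<exists>m\<le>N. \<forall>n\<le>L. mem_mod1 (y (m + n)) {t..t + w}"
proof -
  have "0 < N" using turn by (cases N) auto
  then have v_nonneg: "0 \<le> v" using step[of 0] by force
  define z where "z = \<lceil>y 0 - t\<rceil>"
  have "t + of_int z \<in> {y 0..y N}" using turn unfolding z_def by auto linarith+
  then obtain m where hit: "m \<le> N" "y m \<in> {t + of_int z..t + of_int z + v}"
    using bounded_steps_hit[of N y v] step v_nonneg by force
  have "mem_mod1 (y (m + n)) {t..t + w}" if "n \<le> L" for n
  proof -
    have "y (m + n) - y m \<in> {real n * 0..real n * v}"
      using step hit(1) that by (intro diff_bounds_of_step_bounds) auto
    moreover have "real n * v \<le> real L * v" using that v_nonneg by (intro mult_right_mono) auto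
    ultimately have "y (m + n) - of_int z \<in> {t..t + w}"
      using hit(2) width by (auto simp: algebra_simps)
    then show ?thesis unfolding mem_mod1_def by blast
  qed
  with hit(1) show ?thesis by blast
qed

lemma slow_sweep_mod1_stays:
  fixes x :: "nat \<Rightarrow> real"
  assumes step: "\<And>n. n < N + L \<Longrightarrow> mem_mod1 (x (Suc n) - x n) {l..v}"
    and "0 \<le> l" "1 \<le> real N * l" "(real L + 1) * v \<le> w"
  shows "\<exists>m\<le>N. \<forall>n\<le>L. mem_mod1 (x (m + n)) {t..t + w}"
proof -
  obtain y where y_lift: "\<And>n. y n - x n \<in> \<int>" and y_step: "\<And>n. n < N + L \<Longrightarrow> y (Suc n) - y n \<in> {l..v}"
    using mem_mod1_steps_lift[of "N + L" x "{l..v}"] step by blast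
  have "\<exists>m\<le>N. \<forall>n\<le>L. mem_mod1 (y (m + n)) {t..t + w}"
  proof (rule slow_sweep_stays)
    show "y (Suc n) - y n \<in> {0..v}" if "n < N + L" for n using y_step[OF that] assms(2) by auto
    have "y (0 + N) - y 0 \<in> {real N * l..real N * v}" using y_step
      by (intro diff_bounds_of_step_bounds) auto
    then show "1 \<le> y N - y 0" using assms(3) by auto
  qed (fact assms(4))
  then show ?thesis using y_lift by (meson mem_mod1_diff_Ints)
qed

definition fwd_diff :: "('a::{plus,one} \<Rightarrow> 'b::minus) \<Rightarrow> 'a \<Rightarrow> 'b" where
  "fwd_diff f x = f (x + 1) - f x"

lemma fwd_diff_funpow_of_nat:
  "(fwd_diff ^^ j) (\<lambda>n. f (of_nat n)) n = (fwd_diff ^^ j) f (of_nat n :: 'a::semiring_1)"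
  by (induction j arbitrary: n) (simp_all add: fwd_diff_def add.commute)

lemma fwd_diff_funpow_minus_affine:
  fixes p :: "nat \<Rightarrow> 'a::field"
  assumes "1 \<le> j"
  shows "(fwd_diff ^^ j) (\<lambda>n. (p n - of_nat n - s) / R) n
    = ((fwd_diff ^^ j) p n - of_bool (j = 1)) / R"
  using assms
  by (induction j arbitrary: n rule: nat_induct_at_least)
    (auto simp: fwd_diff_def diff_divide_distrib add_divide_distrib)

lemma fwd_diff_funpow_mvt:
  fixes D :: "nat \<Rightarrow> real \<Rightarrow> real"
  assumes "\<And>i y. x \<le> y \<Longrightarrow> (D i has_real_derivative D (Suc i) y) (at y)"
  shows "\<exists>s\<in>{x..x + real j}. (fwd_diff ^^ j) (D 0) x = D j s"
  using assms
proof (induction j arbitrary: D)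
  case 0
  show ?case by simp
next
  case (Suc j)
  have "(fwd_diff (D i) has_real_derivative fwd_diff (D (Suc i)) y) (at y)" if "x \<le> y" for i y
    unfolding fwd_diff_def using that
    by (intro DERIV_diff Suc.prems DERIV_shift[THEN iffD1]) auto
  then obtain s where s_mem: "s \<in> {x..x + real j}"
      and s_eq: "(fwd_diff ^^ j) (fwd_diff (D 0)) x = fwd_diff (D j) s"
    using Suc.IH[of "\<lambda>i. fwd_diff (D i)"] by blast
  obtain s' where "s < s'" "s' < s + 1" "D j (s + 1) - D j s = (s + 1 - s) * D (Suc j) s'"
    using MVT2[of s "s + 1" "D j" "D (Suc j)"] Suc.prems s_mem by force
  moreover have "(fwd_diff ^^ Suc j) (D 0) x = fwd_diff (D j) s"
    using s_eq by (simp only: funpow_Suc_right comp_apply)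
  moreover have "fwd_diff (D j) s = D j (s + 1) - D j s" by (rule fwd_diff_def)
  ultimately show ?case using s_mem by (intro bexI[of _ s']) auto
qed

definition falling_fact :: "'a::comm_ring_1 \<Rightarrow> nat \<Rightarrow> 'a" where
  "falling_fact c j = (\<Prod>i<j. c - of_nat i)"

lemma falling_fact_nonneg:
  fixes c :: "'a::linordered_idom"
  assumes "of_nat j \<le> c + 1"
  shows "0 \<le> falling_fact c j"
  unfolding falling_fact_def
proof (rule prod_nonneg)
  fix i assume "i \<in> {..<j}"
  then have "of_nat (Suc i) \<le> (of_nat j :: 'a)" by (intro of_nat_mono) auto
  with assms show "0 \<le> c - of_nat i" by simp
qed

lemma falling_fact_ge_1:
  fixes c :: "'a::linordered_idom"
  assumes "of_nat j \<le> c"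
  shows "1 \<le> falling_fact c j"
  unfolding falling_fact_def
proof (rule prod_ge_1)
  fix i assume "i \<in> {..<j}"
  then have "of_nat (Suc i) \<le> (of_nat j :: 'a)" by (intro of_nat_mono) auto
  with assms show "1 \<le> c - of_nat i" by (simp add: le_diff_eq)
qed

lemma fwd_diff_funpow_powr:
  assumes "0 < n"
  shows "\<exists>s\<in>{real n..real (n + j)}.
    (fwd_diff ^^ j) (\<lambda>n. real n powr c) n = falling_fact c j * s powr (c - real j)"
proof -
  define D where "D i y = falling_fact c i * y powr (c - real i)" for i and y :: real
  have "(D i has_real_derivative D (Suc i) y) (at y)" if "real n \<le> y" for i y
    unfolding D_def falling_fact_def using assms that
    by (auto intro!: derivative_eq_intros simp: algebra_simps)
  then obtain s where "s \<in> {real n..real n + real j}" "(fwd_diff ^^ j) (D 0) (real n) = D j s"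
    using fwd_diff_funpow_mvt by blast
  moreover have "(fwd_diff ^^ j) (\<lambda>n. real n powr c) n = (fwd_diff ^^ j) (D 0) (real n)"
    using fwd_diff_funpow_of_nat[of j "D 0" n] by (simp add: D_def falling_fact_def)
  ultimately show ?thesis by (auto simp: D_def)
qed

lemma fwd_diff_funpow_powr_bounds_increasing:
  assumes "0 < n" "real j \<le> c"
  shows "(fwd_diff ^^ j) (\<lambda>n. real n powr c) n
    \<in> {falling_fact c j * real n powr (c - j)..falling_fact c j * real (n + j) powr (c - j)}"
proof -
  have "0 \<le> falling_fact c j" using assms(2) by (intro falling_fact_nonneg) auto
  then show ?thesis
    using fwd_diff_funpow_powr[OF assms(1), of j c] assms
    by (auto intro!: mult_left_mono powr_mono2)
qed

lemma fwd_diff_funpow_powr_bounds_decreasing: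
  assumes "0 < n" "c \<le> real j" "real j \<le> c + 1"
  shows "(fwd_diff ^^ j) (\<lambda>n. real n powr c) n \<in> {0..falling_fact c j * real n powr (c - j)}"
proof -
  have "0 \<le> falling_fact c j" using assms(3) by (intro falling_fact_nonneg) auto
  then show ?thesis
    using fwd_diff_funpow_powr[OF assms(1), of j c] assms
    by (auto intro!: mult_left_mono powr_mono2')
qed

primrec level_exp :: "nat \<Rightarrow> nat" where
  "level_exp 0 = 2"
| "level_exp (Suc j) = 2 * level_exp j + 2"

lemma level_exp_add_2: "level_exp j + 2 = 2 ^ (j + 2)"
  by (induction j) simp_all

definition window_width :: "nat \<Rightarrow> nat \<Rightarrow> real" where
  "window_width R j = 1 / real R ^ level_exp j"

definition dwell_time :: "nat \<Rightarrow> nat \<Rightarrow> nat" where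
  "dwell_time R j = R ^ (level_exp j + 1)"

text \<open>The window avoids 0, so that \<open>\<Delta>\<^sup>j f\<close> in turn drives \<open>\<Delta>\<^sup>j\<^sup>-\<^sup>1 f\<close> forward.\<close>

definition steady :: "nat \<Rightarrow> (nat \<Rightarrow> real) \<Rightarrow> nat \<Rightarrow> nat \<Rightarrow> bool" where
  "steady R f j m \<longleftrightarrow> (\<forall>n\<le>dwell_time R j.
     mem_mod1 ((fwd_diff ^^ j) f (m + n)) {window_width R j..2 * window_width R j})"

lemma window_width_eq: "0 < R \<Longrightarrow> window_width R j = real R / real (dwell_time R j)"
  by (simp add: window_width_def dwell_time_def)

lemma window_width_Suc: "window_width R (Suc j) = 1 / real ((dwell_time R j)\<^sup>2)"
  by (simp add: window_width_def dwell_time_def power_mult power2_eq_square mult_2 power_add)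

lemma dwell_time_Suc: "dwell_time R (Suc j) = R * (dwell_time R j)\<^sup>2"
  by (simp add: dwell_time_def power_mult power2_eq_square mult_2 power_add)

lemma dwell_drift_le_window_width:
  assumes "4 \<le> R"
  shows "(real (dwell_time R j) + 1) * (2 * window_width R (Suc j)) \<le> window_width R j"
proof -
  define d where "d = real (dwell_time R j)"
  have "0 < dwell_time R j" using assms by (simp add: dwell_time_def)
  then have d_ge: "1 \<le> d" by (simp add: d_def)
  then have "(d + 1) * 2 \<le> 4 * d" by simp
  also have "\<dots> \<le> real R * d" using assms d_ge by (intro mult_right_mono) auto
  finally have "(d + 1) * 2 / d\<^sup>2 \<le> real R * d / d\<^sup>2" by (intro divide_right_mono) auto
  then show ?thesis
    using assms d_ge
    by (simp add: window_width_eq window_width_Suc flip: d_def) (simp add: power2_eq_square)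
qed

lemma steady_start:
  assumes "4 \<le> R"
    and step: "\<And>n. X \<le> n \<Longrightarrow> (fwd_diff ^^ Suc k) f n \<in> {0..2 * window_width R (Suc k)}"
    and turn: "1 \<le> (fwd_diff ^^ k) f (X + N) - (fwd_diff ^^ k) f X"
  shows "\<exists>m\<in>{X..X + N}. steady R f k m"
proof -
  have "\<exists>i\<le>N. \<forall>n\<le>dwell_time R k. mem_mod1 ((fwd_diff ^^ k) f (X + (i + n)))
      {window_width R k..window_width R k + window_width R k}"
  proof (rule slow_sweep_stays)
    show "(fwd_diff ^^ k) f (X + Suc n) - (fwd_diff ^^ k) f (X + n)
        \<in> {0..2 * window_width R (Suc k)}" for n
      using step[of "X + n"] by (simp add: fwd_diff_def)
    show "1 \<le> (fwd_diff ^^ k) f (X + N) - (fwd_diff ^^ k) f (X + 0)" using turn by simp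
  qed (rule dwell_drift_le_window_width[OF assms(1)])
  then obtain i where "i \<le> N" "steady R f k (X + i)"
    by (auto simp: steady_def add.assoc)
  then show ?thesis by (intro bexI[of _ "X + i"]) auto
qed

lemma steady_descend:
  assumes "4 \<le> R" "steady R f (Suc j) m"
  shows "\<exists>m'\<ge>m. m' + dwell_time R j \<le> m + dwell_time R (Suc j) \<and> steady R f j m'"
proof -
  define N where "N = (dwell_time R j)\<^sup>2"
  have "dwell_time R j \<le> N" by (simp add: N_def power2_eq_square)
  then have "N + dwell_time R j \<le> 4 * N" by simp
  also have "\<dots> \<le> R * N" using assms(1) by simp
  finally have fits: "N + dwell_time R j \<le> dwell_time R (Suc j)"
    by (simp add: N_def dwell_time_Suc)
  have "\<exists>i\<le>N. \<forall>n\<le>dwell_time R j. mem_mod1 ((fwd_diff ^^ j) f (m + (i + n)))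
      {window_width R j..window_width R j + window_width R j}"
  proof (rule slow_sweep_mod1_stays)
    show "mem_mod1 ((fwd_diff ^^ j) f (m + Suc n) - (fwd_diff ^^ j) f (m + n))
        {window_width R (Suc j)..2 * window_width R (Suc j)}" if "n < N + dwell_time R j" for n
      using assms(2) fits that by (auto simp: steady_def fwd_diff_def)
    show "0 \<le> window_width R (Suc j)" by (simp add: window_width_def)
    show "1 \<le> real N * window_width R (Suc j)"
      using assms(1) by (simp add: N_def window_width_Suc dwell_time_def)
  qed (rule dwell_drift_le_window_width[OF assms(1)])
  then obtain i where "i \<le> N" "steady R f j (m + i)"
    by (auto simp: steady_def add.assoc)
  then show ?thesis using fits by (intro exI[of _ "m + i"]) auto
qed

lemma steady_descend_to_0:
  assumes "4 \<le> R" "steady R f k m"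
  shows "\<exists>m'\<ge>m. m' + dwell_time R 0 \<le> m + dwell_time R k \<and> steady R f 0 m'"
  using assms(2)
proof (induction k arbitrary: m)
  case 0
  then show ?case by blast
next
  case (Suc k)
  then show ?case using steady_descend[OF assms(1) Suc.prems] by (meson order_trans)
qed

lemma floor_cong_of_steady_0:
  assumes "4 \<le> R" "steady R (\<lambda>n. (p n - real n - of_int r) / real R) 0 m"
    and "n \<in> {m..m + R ^ 3}"
  shows "[\<lfloor>p n\<rfloor> = int n + r] (mod int R)"
proof -
  have "2 * window_width R 0 < 1 / real R"
    using assms(1) by (simp add: window_width_def power2_eq_square field_simps)
  moreover have "mem_mod1 ((p n - real n - of_int r) / real R)
      {window_width R 0..2 * window_width R 0}"
    using assms(2,3) unfolding steady_def dwell_time_def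
    by (auto simp: dest: spec[of _ "n - m"])
  moreover have "0 \<le> window_width R 0" by (simp add: window_width_def)
  ultimately have "mem_mod1 ((p n - real n - of_int r) / real R) {0..<1 / real R}"
    by (auto elim!: mem_mod1_mono)
  then show ?thesis
    using assms(1) by (subst floor_cong_iff_mem_mod1) (auto simp: algebra_simps)
qed

lemma powr_le_powr_diff:
  fixes \<theta> x y Y :: real
  assumes "0 \<le> \<theta>" "\<theta> \<le> 1" "3 \<le> Y powr \<theta>" "0 < Y" "0 \<le> x" "x \<le> 2 * Y" "Y\<^sup>2 \<le> y"
  shows "Y powr \<theta> \<le> y powr \<theta> - x powr \<theta>"
proof -
  define u where "u = Y powr \<theta>"
  have "x powr \<theta> \<le> (2 * Y) powr \<theta>" using assms by (intro powr_mono2) auto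
  also have "\<dots> = 2 powr \<theta> * u" using assms(4) by (simp add: powr_mult u_def)
  also have "\<dots> \<le> 2 * u"
    using powr_mono[of \<theta> 1 2] assms(2) by (intro mult_right_mono) (auto simp: u_def)
  finally have x_le: "x powr \<theta> \<le> 2 * u" .
  have "u * u = Y\<^sup>2 powr \<theta>" using assms(4) by (simp add: u_def power2_eq_square powr_mult)
  also have "\<dots> \<le> y powr \<theta>" using assms by (intro powr_mono2) auto
  finally have y_ge: "u * u \<le> y powr \<theta>" .
  have "3 * u \<le> u * u" using assms(3) by (intro mult_right_mono) (auto simp: u_def)
  with x_le y_ge show ?thesis by (simp add: u_def)
qed

lemma powr_le_inverse_power:
  assumes "1 \<le> Q" "Q powr a \<le> x" "real n \<le> a * b" "0 \<le> b"
  shows "x powr - b \<le> 1 / Q ^ n"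
proof -
  have "x powr - b \<le> (Q powr a) powr - b"
    using assms by (intro powr_mono2') auto
  also have "\<dots> = Q powr - (a * b)" by (simp add: powr_powr)
  also have "\<dots> \<le> Q powr - real n" using assms by (intro powr_mono) auto
  also have "\<dots> = 1 / Q ^ n"
    using assms(1) by (simp add: powr_minus powr_realpow divide_inverse)
  finally show ?thesis .
qed

lemma fwd_diff_funpow_powr_small:
  fixes c a :: real and k R n :: nat
  assumes "1 \<le> R" "falling_fact c (Suc k) \<le> real R" "real k \<le> c" "c \<le> real k + 1"
    and "real (level_exp (Suc k)) \<le> a * (real k + 1 - c)" "real R powr a \<le> real n"
  shows "(fwd_diff ^^ Suc k) (\<lambda>n. real n powr c) n \<in> {0..real R * window_width R (Suc k)}"
proof -
  have "real n powr - (real k + 1 - c) \<le> 1 / real R ^ level_exp (Suc k)"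
    using assms by (intro powr_le_inverse_power[where a = a]) auto
  moreover have "c - real (Suc k) = - (real k + 1 - c)" by simp
  ultimately have "real n powr (c - real (Suc k)) \<le> window_width R (Suc k)"
    by (simp only: window_width_def)
  then have "falling_fact c (Suc k) * real n powr (c - real (Suc k))
      \<le> real R * window_width R (Suc k)"
    using assms(2) by (intro mult_mono) auto
  moreover have "0 < real R powr a" using assms(1) by simp
  then have "0 < n" using assms(6) by linarith
  then have "(fwd_diff ^^ Suc k) (\<lambda>n. real n powr c) n
      \<in> {0..falling_fact c (Suc k) * real n powr (c - real (Suc k))}"
    using assms(3,4) by (intro fwd_diff_funpow_powr_bounds_decreasing) auto
  ultimately show ?thesis by (meson atLeastAtMost_iff order_trans)
qed

lemma fwd_diff_funpow_powr_gap:
  fixes c Y :: real and k X N :: nat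
  assumes "real k \<le> c" "c \<le> real k + 1" "0 < X"
    and "3 \<le> Y powr (c - real k)" "0 < Y" "real (X + k) \<le> 2 * Y" "Y\<^sup>2 \<le> real (X + N)"
  shows "Y powr (c - real k)
    \<le> (fwd_diff ^^ k) (\<lambda>n. real n powr c) (X + N) - (fwd_diff ^^ k) (\<lambda>n. real n powr c) X"
proof -
  define gap where "gap = real (X + N) powr (c - real k) - real (X + k) powr (c - real k)"
  have gap_ge: "Y powr (c - real k) \<le> gap"
    unfolding gap_def using assms by (intro powr_le_powr_diff) auto
  also have "1 * gap \<le> falling_fact c k * gap"
    using falling_fact_ge_1[OF assms(1)] gap_ge assms(4) by (intro mult_right_mono) auto
  then have "gap \<le> falling_fact c k * gap" by simp
  also have "\<dots> = falling_fact c k * real (X + N) powr (c - real k)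
      - falling_fact c k * real (X + k) powr (c - real k)"
    by (simp add: gap_def right_diff_distrib)
  also have "\<dots> \<le> (fwd_diff ^^ k) (\<lambda>n. real n powr c) (X + N)
      - (fwd_diff ^^ k) (\<lambda>n. real n powr c) X"
  proof (rule diff_mono)
    show "falling_fact c k * real (X + N) powr (c - real k)
        \<le> (fwd_diff ^^ k) (\<lambda>n. real n powr c) (X + N)"
      using fwd_diff_funpow_powr_bounds_increasing[of "X + N" k c] assms(1,3) by simp
    show "(fwd_diff ^^ k) (\<lambda>n. real n powr c) X \<le> falling_fact c k * real (X + k) powr (c - real k)"
      using fwd_diff_funpow_powr_bounds_increasing[of X k c] assms(1,3) by simp
  qed
  finally show ?thesis .
qed

lemma steady_minus_affine_exists:
  assumes "4 \<le> R" "1 \<le> k"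
    and step: "\<And>n. X \<le> n \<Longrightarrow> (fwd_diff ^^ Suc k) p n \<in> {0..real R * window_width R (Suc k)}"
    and turn: "real R \<le> (fwd_diff ^^ k) p (X + N) - (fwd_diff ^^ k) p X"
  shows "\<exists>m\<in>{X..X + N}. steady R (\<lambda>n. (p n - real n - s) / real R) k m"
proof (rule steady_start[OF assms(1)])
  fix n assume "X \<le> n"
  from step[OF this]
  show "(fwd_diff ^^ Suc k) (\<lambda>n. (p n - real n - s) / real R) n \<in> {0..2 * window_width R (Suc k)}"
    using assms(1,2) fwd_diff_funpow_minus_affine[of "Suc k" p s "real R" n]
    by (simp add: divide_le_eq mult.commute window_width_def del: funpow.simps)
next
  show "1 \<le> (fwd_diff ^^ k) (\<lambda>n. (p n - real n - s) / real R) (X + N)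
      - (fwd_diff ^^ k) (\<lambda>n. (p n - real n - s) / real R) X"
    using assms(1,2) turn
    by (simp add: fwd_diff_funpow_minus_affine diff_divide_distrib[symmetric])
qed

lemma steady_powr_exists:
  fixes c a s :: real and k R :: nat
  assumes "4 \<le> R" "k + 1 \<le> R" "falling_fact c (Suc k) \<le> real R" "1 \<le> a"
    and "1 \<le> k" and k_le_c: "real k \<le> c" and c_le: "c \<le> real k + 1"
    and "real (level_exp (Suc k)) \<le> a * (real k + 1 - c)"
    and far: "1 \<le> a * (c - real k)"
  shows "\<exists>m>0. real m \<le> (real R powr a)\<^sup>2 + real R powr a + 2 \<and>
    steady R (\<lambda>n. (real n powr c - real n - s) / real R) k m"
proof -
  define Y where "Y = real R powr a"
  define X where "X = nat \<lceil>Y\<rceil>"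
  define N where "N = nat \<lceil>Y\<^sup>2\<rceil>"
  have R_ge: "4 \<le> real R" using assms(1) by simp
  have "real R powr 1 \<le> Y" unfolding Y_def using R_ge assms(4) by (intro powr_mono) auto
  then have Y_ge: "real R \<le> Y" by simp
  have X_bounds: "Y \<le> real X" "real X \<le> Y + 1" "0 < X" using Y_ge R_ge unfolding X_def by linarith+
  have "0 \<le> Y\<^sup>2" by simp
  then have N_bounds: "Y\<^sup>2 \<le> real N" "real N \<le> Y\<^sup>2 + 1" unfolding N_def by linarith+
  have "\<exists>m\<in>{X..X + N}. steady R (\<lambda>n. (real n powr c - real n - s) / real R) k m"
  proof (rule steady_minus_affine_exists[OF assms(1) assms(5)])
    fix n assume "X \<le> n"
    then show "(fwd_diff ^^ Suc k) (\<lambda>n. real n powr c) n \<in> {0..real R * window_width R (Suc k)}"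
      using assms X_bounds(1) R_ge
      by (intro fwd_diff_funpow_powr_small[where a = a]) (auto simp: Y_def)
  next
    have "real R powr 1 \<le> real R powr (a * (c - k))" using R_ge far by (intro powr_mono) auto
    then have R_le: "real R \<le> Y powr (c - k)" by (simp add: Y_def powr_powr)
    also have "\<dots> \<le> (fwd_diff ^^ k) (\<lambda>n. real n powr c) (X + N)
        - (fwd_diff ^^ k) (\<lambda>n. real n powr c) X"
      using R_ge Y_ge X_bounds N_bounds k_le_c c_le assms(2) R_le
      by (intro fwd_diff_funpow_powr_gap) auto
    finally show "real R \<le> (fwd_diff ^^ k) (\<lambda>n. real n powr c) (X + N)
        - (fwd_diff ^^ k) (\<lambda>n. real n powr c) X" .
  qed
  then obtain m where m_mem: "m \<in> {X..X + N}"
      and "steady R (\<lambda>n. (real n powr c - real n - s) / real R) k m"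
    by blast
  moreover from m_mem have "0 < m" "real m \<le> Y\<^sup>2 + Y + 2" using X_bounds(2,3) N_bounds(2) by auto
  ultimately show ?thesis unfolding Y_def by blast
qed

lemma quadratic_le_cube:
  fixes x :: "'a::linordered_field"
  assumes "3 \<le> x"
  shows "x\<^sup>2 + 2 * x + 2 \<le> x ^ 3"
proof -
  have "3 * x \<le> x\<^sup>2" "3 * x\<^sup>2 \<le> x ^ 3"
    using assms by (simp_all add: power2_eq_square power3_eq_cube)
  with assms show ?thesis by linarith
qed

lemma floor_powr_cong_run_exists:
  fixes c a :: real and k R :: nat and r :: int
  assumes "4 \<le> R" "k + 1 \<le> R" "falling_fact c (Suc k) \<le> real R"
    and "1 \<le> k" and k_less_c: "real k < c" and "c < real k + 1"
    and slow: "real (level_exp (Suc k)) \<le> a * (real k + 1 - c)"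
    and far: "1 \<le> a * (c - real k)"
  shows "\<exists>m>0. real (m + R ^ 3) \<le> real R powr (3 * a) \<and>
    (\<forall>n\<in>{m..m + R ^ 3}. [\<lfloor>real n powr c\<rfloor> = int n + r] (mod int R))"
proof -
  define Y where "Y = real R powr a"
  have R_ge: "4 \<le> real R" using assms(1) by simp
  have "0 < a" using far k_less_c by (smt (verit) mult_nonpos_nonneg)
  then have "a * (real k + 1 - c) \<le> a * 1" using k_less_c by (intro mult_left_mono) auto
  then have a_ge: "real (level_exp (Suc k)) \<le> a" using slow by linarith
  obtain m0 where m0_bounds: "0 < m0" "real m0 \<le> Y\<^sup>2 + Y + 2"
      and steady_m0: "steady R (\<lambda>n. (real n powr c - real n - of_int r) / real R) k m0"
    unfolding Y_def using steady_powr_exists[of R k c a] assms a_ge by auto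
  obtain m where m_bounds: "m0 \<le> m" "m + dwell_time R 0 \<le> m0 + dwell_time R k"
      and steady_m: "steady R (\<lambda>n. (real n powr c - real n - of_int r) / real R) 0 m"
    using steady_descend_to_0[OF assms(1) steady_m0] by blast
  have "real (dwell_time R k) = R powr real (level_exp k + 1)"
    using R_ge by (simp only: dwell_time_def powr_realpow of_nat_power)
  also have "\<dots> \<le> Y" unfolding Y_def using R_ge a_ge by (intro powr_mono) auto
  finally have "real (dwell_time R k) \<le> Y" .
  moreover have "real (m + R ^ 3) \<le> real (m0 + dwell_time R k)"
    using m_bounds(2) by (intro of_nat_mono) (simp add: dwell_time_def)
  ultimately have "real (m + R ^ 3) \<le> Y\<^sup>2 + 2 * Y + 2" using m0_bounds(2) by simp
  also have "\<dots> \<le> Y ^ 3"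
  proof (rule quadratic_le_cube)
    have "R powr 1 \<le> Y" unfolding Y_def using R_ge a_ge by (intro powr_mono) auto
    then show "3 \<le> Y" using R_ge by simp
  qed
  also have "\<dots> = real R powr (3 * a)"
    using R_ge by (simp add: Y_def powr_power mult.commute)
  finally have "real (m + R ^ 3) \<le> real R powr (3 * a)" .
  moreover have "0 < m" using m_bounds(1) m0_bounds(1) by simp
  ultimately show ?thesis using floor_cong_of_steady_0[OF assms(1) steady_m] by blast
qed

lemma cong_run_imp_cong_at_multiple:
  fixes F :: "nat \<Rightarrow> int" and R m L H :: nat
  assumes "0 < R" "R + H \<le> L"
    and run: "\<And>n. n \<in> {m..m + L} \<Longrightarrow> [F n = int n + r] (mod int R)"
  shows "\<exists>M\<in>{m..m + L}. \<forall>h\<le>H. [F (M + h) = r + int h] (mod int R)"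
proof -
  define M where "M = R * (m div R + 1)"
  have M_bounds: "m \<le> M" "M \<le> m + R"
    using mult_div_mod_eq[of R m] mod_less_divisor[OF assms(1), of m]
    unfolding M_def by (simp_all only: distrib_left mult_1_right)
  have "[F (M + h) = r + int h] (mod int R)" if "h \<le> H" for h
  proof -
    have "[F (M + h) = int (M + h) + r] (mod int R)"
      using M_bounds that assms(2) by (intro run) auto
    moreover have "[int (M + h) + r = r + int h] (mod int R)"
      by (simp add: M_def cong_iff_dvd_diff)
    ultimately show ?thesis by (rule cong_trans)
  qed
  then show ?thesis using M_bounds assms(2) by (intro bexI[of _ M]) auto
qed

lemma level_exp_Suc_le:
  assumes "1 \<le> c" "real k \<le> c"
  shows "real (level_exp (Suc k)) \<le> 2 powr (c + 2) * (c + 2)\<^sup>2 / 3"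
proof -
  have "real (level_exp (Suc k) + 2) = 2 * 2 powr (real k + 2)"
    unfolding level_exp_add_2 by (simp add: powr_add powr_realpow)
  moreover have "(2::real) powr (real k + 2) \<le> 2 powr (c + 2)"
    using assms by (intro powr_mono) auto
  moreover have "0 \<le> 2 powr (c + 2)" by simp
  ultimately have "real (level_exp (Suc k)) \<le> 2 powr (c + 2) * 3" by linarith
  also have "\<dots> \<le> 2 powr (c + 2) * ((c + 2)\<^sup>2 / 3)"
    using power_mono[of 3 "c + 2" 2] assms(1) by (intro mult_left_mono) auto
  finally show ?thesis by simp
qed

lemma floor_powr_cong_shift_exists:
  fixes c \<beta> :: real and R H :: nat and r :: int
  assumes "1 < c" "c \<notin> \<int>"
    and \<beta>_eq: "\<beta> = 2 powr (c + 2) * (c + 2)\<^sup>2 / dist_nearest_int c"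
    and R_ge: "4 \<le> R" "nat \<lfloor>c\<rfloor> + 1 \<le> R" "falling_fact c (Suc (nat \<lfloor>c\<rfloor>)) \<le> real R"
      "H \<le> R"
  shows "\<exists>m>0. real m \<le> real R powr \<beta> \<and>
    (\<forall>h\<le>H. [\<lfloor>real (m + h) powr c\<rfloor> = r + int h] (mod int R))"
proof -
  define k where "k = nat \<lfloor>c\<rfloor>"
  define e where "e = dist_nearest_int c"
  have k_eq: "real k = of_int \<lfloor>c\<rfloor>" and k_ge: "1 \<le> k" unfolding k_def using assms(1) by linarith+
  have frac_eq: "frac c = c - real k" by (simp add: frac_def k_eq)
  have "0 < frac c" using assms(2) frac_gt_0_iff by blast
  then have c_bounds: "real k < c" "c < real k + 1" using frac_eq frac_lt_1[of c] by linarith+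
  have e_bounds: "0 < e" "e \<le> c - real k" "e \<le> real k + 1 - c"
    using c_bounds unfolding e_def dist_nearest_int_def frac_eq by auto
  have exponent_ge: "real (level_exp (Suc k)) \<le> \<beta> / 3 * x" if "e \<le> x" for x
  proof -
    have "0 \<le> \<beta> / 3" using e_bounds(1) unfolding \<beta>_eq e_def by simp
    then have "\<beta> / 3 * e \<le> \<beta> / 3 * x" using that by (rule mult_left_mono[rotated])
    moreover have "\<beta> / 3 * e = 2 powr (c + 2) * (c + 2)\<^sup>2 / 3"
      using e_bounds(1) by (simp add: \<beta>_eq e_def)
    ultimately show ?thesis using level_exp_Suc_le[of c k] assms(1) c_bounds(1) by linarith
  qed
  have "1 \<le> \<beta> / 3 * (c - real k)" using exponent_ge[OF e_bounds(2)] by simp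
  then obtain m where m_bounds: "0 < m" "real (m + R ^ 3) \<le> real R powr (3 * (\<beta> / 3))"
      and run: "\<And>n. n \<in> {m..m + R ^ 3} \<Longrightarrow> [\<lfloor>real n powr c\<rfloor> = int n + r] (mod int R)"
    using floor_powr_cong_run_exists[OF R_ge(1-3)[folded k_def] k_ge c_bounds
        exponent_ge[OF e_bounds(3)]]
    by blast
  have "R + H \<le> R * 4" using R_ge(1,4) by simp
  also have "\<dots> \<le> R * (R * R)" using R_ge(1) mult_le_mono[of 4 R 1 R] by (intro mult_le_mono) auto
  finally have "R + H \<le> R ^ 3" by (simp add: power3_eq_cube)
  then obtain M where M_mem: "M \<in> {m..m + R ^ 3}"
      and M_cong: "\<forall>h\<le>H. [\<lfloor>real (M + h) powr c\<rfloor> = r + int h] (mod int R)"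
    using cong_run_imp_cong_at_multiple[of R H "R ^ 3" m "\<lambda>n. \<lfloor>real n powr c\<rfloor>" r] run R_ge(1)
    by auto
  have "real M \<le> real (m + R ^ 3)" using M_mem by (intro of_nat_mono) simp
  then have "real M \<le> real R powr \<beta>" using m_bounds(2) by simp
  then show ?thesis using M_mem M_cong m_bounds(1) by (intro exI[of _ M]) auto
qed

theorem theorem3:
  fixes c \<beta> :: real and H :: int
  assumes "c > 1" and "c \<notin> \<int>"
    and "\<beta> = 2 powr (c + 2) * (c + 2)\<^sup>2 / dist_nearest_int c"
    and "H > 0"
  shows "\<exists>R0::int. \<forall>R\<ge>R0. \<forall>r::int. \<exists>m::int. m > 0 \<and> real_of_int m \<le> real_of_int R powr \<beta> \<and>
           (\<forall>h\<in>{1..H}. [\<lfloor>real_of_int (m + h) powr c\<rfloor> = r + h] (mod R))"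
proof (rule exI, intro allI impI)
  fix R r :: int
  assume "max (max 4 H) (max (\<lfloor>c\<rfloor> + 1) \<lceil>falling_fact c (Suc (nat \<lfloor>c\<rfloor>))\<rceil>) \<le> R"
  then have R_ge: "4 \<le> R" "H \<le> R" "\<lfloor>c\<rfloor> + 1 \<le> R" "falling_fact c (Suc (nat \<lfloor>c\<rfloor>)) \<le> of_int R"
    by (auto simp: ceiling_le_iff)
  then have "4 \<le> nat R" "nat \<lfloor>c\<rfloor> + 1 \<le> nat R" "falling_fact c (Suc (nat \<lfloor>c\<rfloor>)) \<le> real (nat R)"
      "nat H \<le> nat R"
    using assms(1) by auto
  then obtain m where m_bounds: "0 < m" "real m \<le> real (nat R) powr \<beta>"
      and m_cong: "\<And>h. h \<le> nat H \<Longrightarrow> [\<lfloor>real (m + h) powr c\<rfloor> = r + int h] (mod int (nat R))"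
    using floor_powr_cong_shift_exists[OF assms(1-3)] by blast
  have "[\<lfloor>real_of_int (int m + h) powr c\<rfloor> = r + h] (mod R)" if "h \<in> {1..H}" for h
    using m_cong[of "nat h"] that R_ge(1) by (simp add: nat_mono)
  then show "\<exists>m::int. m > 0 \<and> real_of_int m \<le> real_of_int R powr \<beta> \<and>
      (\<forall>h\<in>{1..H}. [\<lfloor>real_of_int (m + h) powr c\<rfloor> = r + h] (mod R))"
    using m_bounds R_ge(1) by (intro exI[of _ "int m"]) auto
qed

end
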